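(* Let $A,T\in\mathbb{C}^{n\times n}$, $T$ a partial isometry, and $r=\operatorname{rank}(A)$. Then the following are equivalent: (i) $A$ is $T$-EP; (ii) there exist a nonsingular matrix $D\in\mathbb{C}^{r\times r}$ and a unitary matrix $U\in\mathbb{C}^{n\times n}$ such that $$A=U\begin{bmatrix} D & 0\\ 0 & 0\end{bmatrix}U^*T,$$ where $T=U\begin{bmatrix} T_1 & T_2\\ T_3 & T_4\end{bmatrix}U^*$ (partitioned with $T_1\in\mathbb{C}^{r\times r}$ and the other blocks of conforming sizes) with $T_1T_1^*+T_2T_2^*=I_r$ and $T_3T_1^*+T_4T_2^*=0$; (iii) there exists an EP matrix $C\in\mathbb{C}^{n\times n}$ such that $A=CT$ and $TT^*C=C$. In particular, under any one of the equivalent conditions (i)-(iii), the matrix $C$ in (iii) satisfies $CTT^*=C$.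
   Context: $\mathcal{R}(\cdot)$ denotes the range space and $^*$ the conjugate transpose. A matrix $T$ is a partial isometry if $T=TT^*T$. A square matrix $C$ is EP if $\mathcal{R}(C)=\mathcal{R}(C^* )$. Given a partial isometry $T\in\mathbb{C}^{n\times n}$, a matrix $A\in\mathbb{C}^{n\times n}$ is $T$-EP if $\mathcal{R}(A)=\mathcal{R}(TA^*T)$ and $A=AT^*T$. *)

theory Defs
  imports
    "Jordan_Normal_Form.Schur_Decomposition"
    "Jordan_Normal_Form.DL_Rank"
begin

definition range_space :: "complex mat \<Rightarrow> complex vec set" where
  "range_space A = {A *\<^sub>v x | x. x \<in> carrier_vec (dim_col A)}"

lemma range_space_eq_col_space:
  assumes "A \<in> carrier_mat m n"
  shows "range_space A = vec_space.col_space m A"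
  using assms by (auto simp: range_space_def vec_space.col_space_eq[OF assms])

definition unitary_mat :: "complex mat \<Rightarrow> bool" where
  "unitary_mat U \<longleftrightarrow> square_mat U \<and>
     U * mat_adjoint U = 1\<^sub>m (dim_row U) \<and> mat_adjoint U * U = 1\<^sub>m (dim_row U)"

definition partial_isometry :: "complex mat \<Rightarrow> bool" where
  "partial_isometry T \<longleftrightarrow> T = T * mat_adjoint T * T"

definition EP_mat :: "complex mat \<Rightarrow> bool" where
  "EP_mat C \<longleftrightarrow> square_mat C \<and> range_space C = range_space (mat_adjoint C)"

text \<open>Only meaningful when \<open>T\<close> is a partial isometry and \<open>A\<close>, \<open>T\<close> are square of
  the same size; these are assumptions of every statement about it.\<close>

definition T_EP_mat :: "complex mat \<Rightarrow> complex mat \<Rightarrow> bool" where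
  "T_EP_mat T A \<longleftrightarrow>
     range_space A = range_space (T * mat_adjoint A * T) \<and> A = A * mat_adjoint T * T"

end

theory Submission
  imports Defs
begin

text \<open>
  Write \<open>P = T T\<^sup>*\<close>, the orthogonal projection onto the range of the partial isometry \<open>T\<close>.
  The link between the conditions is the EP factor \<open>C\<close> of \<open>A = C T\<close>.

  If \<open>A\<close> is \<open>T\<close>-EP then \<open>C = A T\<^sup>*\<close> works (\<open>T_EP_imp_EP_factor\<close>): the identity \<open>A = A T\<^sup>* T\<close> says
  \<open>C T = A\<close> and gives \<open>C\<close> the range of \<open>A\<close>; the range condition puts this range inside that of \<open>T\<close>,
  so that \<open>P\<close> fixes \<open>A\<close>, and then \<open>C\<^sup>* = T A\<^sup>*\<close> has the same range as \<open>T A\<^sup>* T\<close>.  Conversely, if \<open>C\<close> is EP and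
  \<open>P C = C\<close>, then \<open>P\<close> also fixes \<open>C\<^sup>*\<close>, whose range is that of \<open>C\<close>; taking adjoints, \<open>C P = C\<close>
  (\<open>EP_mat_absorb_right\<close>).  This is the last claim of the theorem, and it makes \<open>C T\<close> a \<open>T\<close>-EP matrix
  with the range of \<open>C\<close> (\<open>EP_factor_imp_T_EP\<close>).

  For the block form, an EP matrix maps its range bijectively to itself and annihilates the orthogonal
  complement of that range.  In an orthonormal basis adapted to this splitting it becomes
  \<open>diag(D, 0)\<close> with \<open>D\<close> nonsingular of size \<open>rank C = rank A\<close> (\<open>EP_mat_block_form\<close>,
  \<open>EP_mat_of_block_form\<close>).  In the same basis the first block column of \<open>P\<close> consists of
  \<open>T\<^sub>1 T\<^sub>1\<^sup>* + T\<^sub>2 T\<^sub>2\<^sup>*\<close> and \<open>T\<^sub>3 T\<^sub>1\<^sup>* + T\<^sub>4 T\<^sub>2\<^sup>*\<close>, so cancelling \<open>D\<close> in \<open>P C = C\<close> leaves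
  exactly the two conditions on the blocks of \<open>T\<close> (\<open>block_rows_orthonormal_iff\<close>).

  Range equalities are handled throughout as pairs of factorizations \<open>X = Y Z\<close>
  (\<open>range_space_subset_iff\<close>), which reduces most arguments to matrix identities.
\<close>

section \<open>The conjugate transpose\<close>

text \<open>Associativity with the dimension conditions as equations between dimensions: the simplifier can
  then discharge them for rectangular factors, where the inner dimensions in the carrier version
  would have to be guessed.\<close>

lemma mult_mat_assoc:
  "dim_col A = dim_row B \<Longrightarrow> dim_col B = dim_row C \<Longrightarrow> (A * B) * C = A * (B * (C :: complex mat))"
  by (rule assoc_mult_mat[of _ "dim_row A" "dim_row B" _ "dim_row C" _ "dim_col C"]) auto

lemma mult_mat_carrier_iff [simp]:
  "A * B \<in> carrier_mat m n \<longleftrightarrow> dim_row A = m \<and> dim_col B = n"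
  unfolding carrier_mat_def by simp

lemma dim_mat_adjoint [simp]:
  "dim_row (mat_adjoint A) = dim_col A" "dim_col (mat_adjoint A) = dim_row A"
  by (auto simp: mat_adjoint_def)

lemma mat_adjoint_carrier [simp]: "A \<in> carrier_mat m n \<Longrightarrow> mat_adjoint A \<in> carrier_mat n m"
  by (auto intro!: carrier_matI)

lemma index_mat_adjoint [simp]:
  "i < dim_col A \<Longrightarrow> j < dim_row A \<Longrightarrow> mat_adjoint A $$ (i, j) = conjugate (A $$ (j, i))"
  by (auto simp: mat_adjoint_def mat_of_rows_def)

lemma mat_adjoint_adjoint [simp]: "mat_adjoint (mat_adjoint (A :: complex mat)) = A"
  by (rule eq_matI) auto

lemma mat_adjoint_zero [simp]: "mat_adjoint (0\<^sub>m m n :: complex mat) = 0\<^sub>m n m"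
  by (rule eq_matI) auto

lemma mat_adjoint_one [simp]: "mat_adjoint (1\<^sub>m n :: complex mat) = 1\<^sub>m n"
  by (rule eq_matI) auto

lemma mat_adjoint_mult:
  "dim_col A = dim_row B \<Longrightarrow> mat_adjoint (A * (B :: complex mat)) = mat_adjoint B * mat_adjoint A"
  by (rule eq_matI) (auto simp: scalar_prod_def mult.commute intro!: sum.cong)

lemma mat_adjoint_minus:
  assumes "A \<in> carrier_mat m n" and "B \<in> carrier_mat m n"
  shows "mat_adjoint (A - (B :: complex mat)) = mat_adjoint A - mat_adjoint B"
  using assms by (intro eq_matI) auto

lemma mat_adjoint_four_block:
  assumes "A \<in> carrier_mat m1 n1" "B \<in> carrier_mat m1 n2" "C \<in> carrier_mat m2 n1" "D \<in> carrier_mat m2 n2"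
  shows "mat_adjoint (four_block_mat A B C D :: complex mat) =
    four_block_mat (mat_adjoint A) (mat_adjoint C) (mat_adjoint B) (mat_adjoint D)"
  using assms by (intro eq_matI) auto

section \<open>Range inclusion as right divisibility\<close>

text \<open>Each column of \<open>X\<close> lies in the range of \<open>Y\<close>, and the preimages of these columns are the
  columns of \<open>Z\<close>.\<close>

lemma range_space_subset_iff:
  assumes X: "X \<in> carrier_mat n m" and Y: "Y \<in> carrier_mat n p"
  shows "range_space X \<subseteq> range_space Y \<longleftrightarrow> (\<exists>Z \<in> carrier_mat p m. X = Y * Z)"
proof
  assume sub: "range_space X \<subseteq> range_space Y"
  have "\<exists>z. z \<in> carrier_vec p \<and> col X j = Y *\<^sub>v z" if "j < m" for j
  proof -
    have "col X j = X *\<^sub>v unit_vec m j"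
      using X that by (intro eq_vecI) (auto simp: scalar_prod_right_unit)
    then have "col X j \<in> range_space X" using X by (auto simp: range_space_def)
    with sub Y show ?thesis by (auto simp: range_space_def)
  qed
  then obtain z where z: "\<And>j. j < m \<Longrightarrow> z j \<in> carrier_vec p \<and> col X j = Y *\<^sub>v z j" by metis
  define Z where "Z = mat p m (\<lambda>(i, j). z j $ i)"
  have col_Z: "col Z j = z j" if "j < m" for j
    using z[OF that] that by (intro eq_vecI) (auto simp: Z_def)
  have "X = Y * Z"
  proof (rule mat_col_eqI)
    fix j assume "j < dim_col (Y * Z)"
    then have "j < m" by (simp add: Z_def)
    then show "col X j = col (Y * Z) j"
      using z[of j] col_Z[of j] Y by (subst col_mult2[of _ n p _ m]) (auto simp: Z_def)
  qed (use X Y in \<open>auto simp: Z_def\<close>)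
  then show "\<exists>Z \<in> carrier_mat p m. X = Y * Z" by (intro bexI[of _ Z]) (auto simp: Z_def)
next
  assume "\<exists>Z \<in> carrier_mat p m. X = Y * Z"
  then obtain Z where Z: "Z \<in> carrier_mat p m" "X = Y * Z" by auto
  have "X *\<^sub>v x \<in> range_space Y" if "x \<in> carrier_vec m" for x
  proof -
    have "X *\<^sub>v x = Y *\<^sub>v (Z *\<^sub>v x)" using that Y Z by simp
    moreover have "Z *\<^sub>v x \<in> carrier_vec (dim_col Y)" using that Y Z by simp
    ultimately show ?thesis by (auto simp only: range_space_def)
  qed
  then show "range_space X \<subseteq> range_space Y"
    unfolding range_space_def[of X] carrier_matD(2)[OF X] by auto
qed

lemma range_space_mult_subset:
  assumes "Y \<in> carrier_mat n p" and "Z \<in> carrier_mat p m"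
  shows "range_space (Y * Z) \<subseteq> range_space Y"
  using assms range_space_subset_iff[of "Y * Z" n m Y p] by auto

lemma rank_cong_range_space:
  assumes "X \<in> carrier_mat n m" and "Y \<in> carrier_mat n p" and "range_space X = range_space Y"
  shows "vec_space.rank n X = vec_space.rank n Y"
  using assms range_space_eq_col_space[OF assms(1)] range_space_eq_col_space[OF assms(2)]
  by (simp add: vec_space.rank_def vec_space.col_space_def)

text \<open>A left inverse forces the columns to be distinct and linearly independent.  The bound
  \<open>k \<le> n\<close> serves to stop the growth of orthonormal systems and to count the vectors of a
  completed one.\<close>

lemma rank_left_invertible:
  assumes V: "(V :: complex mat) \<in> carrier_mat n k" and X: "X \<in> carrier_mat k n" and XV: "X * V = 1\<^sub>m k"
  shows "vec_space.rank n V = k" and "k \<le> n"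
proof -
  interpret vec_space "TYPE(complex)" n .
  have dist: "distinct (cols V)"
    unfolding distinct_conv_nth
  proof (intro allI impI notI)
    fix i j assume ij: "i < length (cols V)" "j < length (cols V)" "i \<noteq> j" and "cols V ! i = cols V ! j"
    then have "col V i = col V j" by simp
    then have "(X * V) $$ (i, i) = (X * V) $$ (i, j)" using ij V X by simp
    then show False using ij V by (simp add: XV)
  qed
  have ind: "lin_indpt (set (cols V))"
  proof
    assume "lin_dep (set (cols V))"
    then obtain v where v: "v \<in> carrier_vec k" "v \<noteq> 0\<^sub>v k" "V *\<^sub>v v = 0\<^sub>v n"
      using lin_depE[OF V _ dist] by metis
    have "v = (X * V) *\<^sub>v v" using v by (simp add: XV)
    also have "\<dots> = X *\<^sub>v (V *\<^sub>v v)" using X V v by simp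
    finally show False using v X by (auto simp: mult_mat_vec_def)
  qed
  show "vec_space.rank n V = k" by (rule lin_indpt_full_rank[OF V dist ind])
  have "card (set (cols V)) \<le> dim"
    using li_le_dim(2)[OF fin_dim _ ind] V cols_dim[of V] by auto
  then show "k \<le> n" using V distinct_card[OF dist] by (simp add: dim_is_n)
qed

section \<open>Orthonormal bases of range spaces\<close>

text \<open>The matrix \<open>[V W]\<close>, as a block matrix whose two lower blocks have no rows; this makes the
  multiplication rule for block matrices applicable to it.\<close>

definition hcat :: "complex mat \<Rightarrow> complex mat \<Rightarrow> complex mat" where
  "hcat V W = four_block_mat V W (0\<^sub>m 0 (dim_col V)) (0\<^sub>m 0 (dim_col W))"

lemma hcat_carrier [simp]:
  "V \<in> carrier_mat n k \<Longrightarrow> W \<in> carrier_mat n l \<Longrightarrow> hcat V W \<in> carrier_mat n (k + l)"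
  by (auto simp: hcat_def)

lemma mult_hcat:
  assumes "A \<in> carrier_mat m n" "V \<in> carrier_mat n k" "W \<in> carrier_mat n l"
  shows "A * hcat V W = hcat (A * V) (A * W)"
proof (rule eq_matI)
  fix i j assume ij: "i < dim_row (hcat (A * V) (A * W))" "j < dim_col (hcat (A * V) (A * W))"
  have "col (hcat V W) j = (if j < k then col V j else col W (j - k))"
    using assms ij by (intro eq_vecI) (auto simp: hcat_def)
  then show "(A * hcat V W) $$ (i, j) = hcat (A * V) (A * W) $$ (i, j)"
    using assms ij by (auto simp: hcat_def)
qed (use assms in \<open>auto simp: hcat_def\<close>)

lemma adjoint_hcat_mult_hcat:
  assumes V: "V \<in> carrier_mat n k" and W: "W \<in> carrier_mat n l"
    and VV: "mat_adjoint V * V = 1\<^sub>m k" and WW: "mat_adjoint W * W = 1\<^sub>m l"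
    and VW: "mat_adjoint V * W = 0\<^sub>m k l"
  shows "mat_adjoint (hcat V W) * hcat V W = 1\<^sub>m (k + l)"
proof -
  have WV: "mat_adjoint W * V = 0\<^sub>m l k"
    using arg_cong[OF VW, of mat_adjoint] V W by (simp add: mat_adjoint_mult)
  have "mat_adjoint (hcat V W) = four_block_mat (mat_adjoint V) (0\<^sub>m k 0) (mat_adjoint W) (0\<^sub>m l 0)"
    using mat_adjoint_four_block[OF V W zero_carrier_mat[of 0] zero_carrier_mat[of 0]] V W by (simp add: hcat_def)
  then show ?thesis
    using V W VV WW VW WV
    by (simp add: hcat_def mult_four_block_mat[of _ k n _ 0 _ l _ _ k _ l])
qed

lemma hcat_block_mult_adjoint_hcat:
  assumes V: "V \<in> carrier_mat n k" and W: "W \<in> carrier_mat n l"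
    and D: "D \<in> carrier_mat k k" and E: "E \<in> carrier_mat l l"
  shows "hcat V W * four_block_mat D (0\<^sub>m k l) (0\<^sub>m l k) E * mat_adjoint (hcat V W) =
    V * D * mat_adjoint V + W * E * mat_adjoint W"
proof -
  have adj: "mat_adjoint (hcat V W) = four_block_mat (mat_adjoint V) (0\<^sub>m k 0) (mat_adjoint W) (0\<^sub>m l 0)"
    using mat_adjoint_four_block[OF V W zero_carrier_mat[of 0] zero_carrier_mat[of 0]] V W by (simp add: hcat_def)
  have "hcat V W * four_block_mat D (0\<^sub>m k l) (0\<^sub>m l k) E = hcat (V * D) (W * E)"
    unfolding hcat_def using V W D E
    by (simp add: mult_four_block_mat[of _ n k _ l _ 0 _ _ k _ l])
  then show ?thesis
    unfolding adj using V W D E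
    by (auto simp: hcat_def mult_four_block_mat[of _ n k _ l _ 0 _ _ n _ 0] intro!: eq_matI)
qed

lemma ex_normalizing_scalar:
  assumes w: "(w :: complex mat) \<in> carrier_mat n 1" and nz: "w \<noteq> 0\<^sub>m n 1"
  obtains c :: complex where "mat_adjoint (c \<cdot>\<^sub>m w) * (c \<cdot>\<^sub>m w) = 1\<^sub>m 1"
proof -
  define s where "s = (\<Sum>i<n. (cmod (w $$ (i, 0)))\<^sup>2)"
  obtain i where "i < n" "w $$ (i, 0) \<noteq> 0"
    using w nz by (metis eq_matI carrier_matD index_zero_mat less_one)
  then have s: "s > 0" unfolding s_def by (intro sum_pos2[of _ i]) auto
  have "mat_adjoint (of_real (1 / sqrt s) \<cdot>\<^sub>m w) * (of_real (1 / sqrt s) \<cdot>\<^sub>m w) = 1\<^sub>m 1" (is "?A = _")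
  proof (rule eq_matI)
    fix i j assume "i < dim_row (1\<^sub>m 1 :: complex mat)" "j < dim_col (1\<^sub>m 1 :: complex mat)"
    then have [simp]: "i = 0" "j = 0" by auto
    have "?A $$ (0, 0) = (\<Sum>i<n. of_real ((cmod (w $$ (i, 0)))\<^sup>2 / s))"
      using w s by (auto simp: scalar_prod_def atLeast0LessThan conjugate_complex_def
          complex_norm_square real_sqrt_mult_self field_simps simp flip: of_real_mult of_real_power
          intro!: sum.cong)
    also have "\<dots> = of_real (s / s)" by (simp only: s_def of_real_sum sum_divide_distrib)
    also have "\<dots> = 1" using s by simp
    finally show "?A $$ (i, j) = 1\<^sub>m 1 $$ (i, j)" by simp
  qed (use w in auto)
  then show ?thesis by (rule that)
qed

text \<open>Take a system of orthonormal vectors in the range of \<open>C\<close> that is as long as possible.  If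
  \<open>V V\<^sup>*\<close> did not fix \<open>C\<close>, a nonzero column of the residual \<open>C - V V\<^sup>* C\<close>, which is orthogonal to
  \<open>V\<close> and lies in the range of \<open>C\<close>, could be normalized and appended.\<close>

lemma ex_orthonormal_basis_of_range:
  assumes C: "(C :: complex mat) \<in> carrier_mat n m"
  obtains k V X where "V \<in> carrier_mat n k" "X \<in> carrier_mat m k" "V = C * X"
    "mat_adjoint V * V = 1\<^sub>m k" "V * mat_adjoint V * C = C"
proof -
  define P where "P = (\<lambda>k. \<exists>V X. V \<in> carrier_mat n k \<and> X \<in> carrier_mat m k \<and> V = C * X \<and> mat_adjoint V * V = 1\<^sub>m k)"
  have "P 0" unfolding P_def
    by (rule exI[of _ "0\<^sub>m n 0"], rule exI[of _ "0\<^sub>m m 0"]) (use C in \<open>auto intro!: eq_matI\<close>)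
  moreover have bound: "k \<le> n" if "P k" for k
    using that rank_left_invertible(2) unfolding P_def by (metis mat_adjoint_carrier)
  ultimately have "P (GREATEST k. P k)" and "\<And>j. P j \<Longrightarrow> j \<le> (GREATEST k. P k)"
    using GreatestI_nat[of P 0 n] Greatest_le_nat[of P _ n] by metis+
  then obtain k where k: "P k" and max: "\<And>j. P j \<Longrightarrow> j \<le> k" by metis
  from k obtain V X where V: "V \<in> carrier_mat n k" and X: "X \<in> carrier_mat m k"
    and VCX: "V = C * X" and VV: "mat_adjoint V * V = 1\<^sub>m k" by (auto simp: P_def)
  note d = carrier_matD[OF V] carrier_matD[OF X] carrier_matD[OF C]
  define R where "R = C - V * (mat_adjoint V * C)"
  have R: "R \<in> carrier_mat n m" using V C by (auto simp: R_def)
  have "R = 0\<^sub>m n m"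
  proof (rule ccontr)
    assume "R \<noteq> 0\<^sub>m n m"
    then obtain i j where ij: "i < n" "j < m" "R $$ (i, j) \<noteq> 0"
      using R by (metis eq_matI carrier_matD index_zero_mat)
    \<comment> \<open>Multiplication by \<open>e\<close> selects the nonzero column \<open>j\<close> of the residual.\<close>
    define e where "e = mat m 1 (\<lambda>(i, _). if i = j then 1 else 0 :: complex)"
    have e: "e \<in> carrier_mat m 1" by (simp add: e_def)
    have "(R * e) $$ (i, 0) = R $$ (i, j)"
      using R e ij by (simp add: scalar_prod_def e_def if_distrib cong: if_cong)
    then have "R * e \<noteq> 0\<^sub>m n 1" using ij by auto
    then obtain c where c: "mat_adjoint (c \<cdot>\<^sub>m (R * e)) * (c \<cdot>\<^sub>m (R * e)) = 1\<^sub>m 1"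
      using ex_normalizing_scalar[of "R * e" n] R e by auto
    define f where "f = c \<cdot>\<^sub>m e"
    have f: "f \<in> carrier_mat m 1" using e by (simp add: f_def)
    have "c \<cdot>\<^sub>m (R * e) = R * f" using R e by (simp add: f_def mult_smult_distrib)
    with c have ww: "mat_adjoint (R * f) * (R * f) = 1\<^sub>m 1" by simp
    have "mat_adjoint V * R = mat_adjoint V * C - mat_adjoint V * V * (mat_adjoint V * C)"
      unfolding R_def using V C by (simp add: mult_minus_distrib_mat[of _ k n _ m] mult_mat_assoc)
    also have "\<dots> = 0\<^sub>m k m" using V C by (auto simp: VV)
    finally have "mat_adjoint V * (R * f) = 0\<^sub>m k 1"
      using V R f by (simp flip: mult_mat_assoc)
    then have "mat_adjoint (hcat V (R * f)) * hcat V (R * f) = 1\<^sub>m (k + 1)"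
      using V R f VV ww by (intro adjoint_hcat_mult_hcat) auto
    moreover have "R * f = C * (f - X * (mat_adjoint V * C * f))"
    proof -
      have "R * f = C * f - V * (mat_adjoint V * C) * f"
        unfolding R_def using V C f by (intro minus_mult_distrib_mat[of _ n m]) auto
      also have "V * (mat_adjoint V * C) * f = C * (X * (mat_adjoint V * C * f))"
        using d f by (subst VCX) (simp add: mult_mat_assoc)
      also have "C * f - \<dots> = C * (f - X * (mat_adjoint V * C * f))"
        using V X C f by (intro mult_minus_distrib_mat[symmetric, of _ n m _ 1]) auto
      finally show ?thesis .
    qed
    then have "hcat V (R * f) = C * hcat X (f - X * (mat_adjoint V * C * f))"
      using V X C f VCX by (subst mult_hcat[of _ n m _ k _ 1]) auto
    moreover have "hcat V (R * f) \<in> carrier_mat n (k + 1)"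
      by (rule hcat_carrier[OF V]) (use R f in auto)
    moreover have "hcat X (f - X * (mat_adjoint V * C * f)) \<in> carrier_mat m (k + 1)"
      by (rule hcat_carrier[OF X]) (use X f in auto)
    ultimately have "P (k + 1)" unfolding P_def by blast
    from max[OF this] show False by simp
  qed
  then have "V * mat_adjoint V * C = C"
    using d unfolding R_def by (auto simp: mult_mat_assoc mat_eq_iff)
  with V X VCX VV show ?thesis by (rule that)
qed

text \<open>\<open>W\<close> is an orthonormal basis of the range of the complementary projection
  \<open>Q = I - V V\<^sup>*\<close>, whence \<open>V V\<^sup>* + W W\<^sup>* = I\<close>.  The number of columns of \<open>W\<close> follows from
  \<open>[V W]\<close> having a left inverse as well as a right inverse.\<close>

lemma ex_orthonormal_complement:
  assumes V: "(V :: complex mat) \<in> carrier_mat n k" and VV: "mat_adjoint V * V = 1\<^sub>m k"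
  obtains W where "W \<in> carrier_mat n (n - k)" "unitary_mat (hcat V W)"
proof -
  define Q where "Q = 1\<^sub>m n - V * mat_adjoint V"
  have Q: "Q \<in> carrier_mat n n" using V by (auto simp: Q_def)
  have adjQ: "mat_adjoint Q = Q"
    using V by (simp add: Q_def mat_adjoint_minus[of _ n n] mat_adjoint_mult)
  have VQ: "mat_adjoint V * Q = 0\<^sub>m k n"
    using V by (simp add: Q_def mult_minus_distrib_mat[of _ k n _ n] VV flip: mult_mat_assoc)
  obtain l W Y where W: "W \<in> carrier_mat n l" and Y: "Y \<in> carrier_mat n l" and WQY: "W = Q * Y"
    and WW: "mat_adjoint W * W = 1\<^sub>m l" and WWQ: "W * mat_adjoint W * Q = Q"
    using ex_orthonormal_basis_of_range[OF Q] by metis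
  note d = carrier_matD[OF V] carrier_matD[OF W] carrier_matD[OF Y] carrier_matD[OF Q]
  have VW: "mat_adjoint V * W = 0\<^sub>m k l"
    unfolding WQY using d by (simp add: VQ left_mult_zero_mat[OF Y] flip: mult_mat_assoc)
  have "Q * W = W - V * (mat_adjoint V * W)"
    unfolding Q_def using V W by (simp add: minus_mult_distrib_mat[of _ n n _ _ l] mult_mat_assoc)
  then have QW: "Q * W = W" using V W by (auto simp: VW)
  have "Q * (W * mat_adjoint W) = Q"
    using arg_cong[OF WWQ, of mat_adjoint] d by (simp add: mat_adjoint_mult adjQ)
  then have "W * mat_adjoint W = Q" using d by (simp add: QW flip: mult_mat_assoc)
  then have sum: "V * mat_adjoint V + W * mat_adjoint W = 1\<^sub>m n"
    using V by (auto simp: Q_def intro!: eq_matI)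
  let ?U = "hcat V W"
  have U: "?U \<in> carrier_mat n (k + l)" using V W by simp
  have UU: "mat_adjoint ?U * ?U = 1\<^sub>m (k + l)" by (rule adjoint_hcat_mult_hcat[OF V W VV WW VW])
  have "four_block_mat (1\<^sub>m k) (0\<^sub>m k l) (0\<^sub>m l k) (1\<^sub>m l) = (1\<^sub>m (k + l) :: complex mat)" by simp
  then have UU': "?U * mat_adjoint ?U = 1\<^sub>m n"
    using hcat_block_mult_adjoint_hcat[OF V W one_carrier_mat one_carrier_mat] U V W by (simp add: sum)
  have "k + l \<le> n" "n \<le> k + l"
    using rank_left_invertible(2)[OF U _ UU] rank_left_invertible(2)[OF _ U UU'] U by auto
  then have l: "k + l = n" "l = n - k" by auto
  have "unitary_mat ?U" using UU UU' U by (simp add: unitary_mat_def l(1))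
  with W show ?thesis by (intro that[of W]) (simp_all add: l(2))
qed

section \<open>Matrices whose range equals the range of the adjoint\<close>

text \<open>Let the columns of \<open>V\<close> be an orthonormal basis of the range of \<open>C\<close>.  Then \<open>V V\<^sup>*\<close> fixes \<open>C\<close> and,
  the ranges being equal, also \<open>C\<^sup>*\<close>, so \<open>C = V V\<^sup>* C V V\<^sup>*\<close> and \<open>D = V\<^sup>* C V\<close> carries all of \<open>C\<close>.
  Completing \<open>V\<close> to a unitary matrix gives the block form.\<close>

lemma EP_mat_block_form:
  assumes C: "C \<in> carrier_mat n n" and EP: "EP_mat C" and r: "r = vec_space.rank n C"
  obtains D U where "D \<in> carrier_mat r r" "invertible_mat D" "U \<in> carrier_mat n n" "unitary_mat U"
    "C = U * four_block_mat D (0\<^sub>m r (n - r)) (0\<^sub>m (n - r) r) (0\<^sub>m (n - r) (n - r)) * mat_adjoint U"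
proof -
  obtain k V X where V: "V \<in> carrier_mat n k" and X: "X \<in> carrier_mat n k" and VCX: "V = C * X"
    and VV: "mat_adjoint V * V = 1\<^sub>m k" and VVC: "V * mat_adjoint V * C = C"
    using ex_orthonormal_basis_of_range[OF C] by metis
  note d = carrier_matD[OF V] carrier_matD[OF X] carrier_matD[OF C]
  have "range_space V = range_space C"
  proof
    show "range_space V \<subseteq> range_space C"
      using range_space_mult_subset[OF C X] by (simp add: VCX)
    have "range_space (V * (mat_adjoint V * C)) \<subseteq> range_space V"
      by (rule range_space_mult_subset[OF V]) (use V C in auto)
    then show "range_space C \<subseteq> range_space V" using VVC d by (simp add: mult_mat_assoc)
  qed
  then have rk: "r = k"
    using rank_cong_range_space[OF V C] rank_left_invertible(1)[OF V _ VV] V r by auto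
  have kn: "k \<le> n" using rank_left_invertible(2)[OF V _ VV] V by auto
  obtain Z where Z: "Z \<in> carrier_mat n n" "mat_adjoint C = C * Z"
    using EP C range_space_subset_iff[of "mat_adjoint C" n n C n] by (auto simp: EP_mat_def)
  have "V * mat_adjoint V * mat_adjoint C = V * mat_adjoint V * C * Z"
    using d Z by (simp add: mult_mat_assoc)
  also have "\<dots> = mat_adjoint C" by (simp add: VVC Z)
  finally have "mat_adjoint (V * mat_adjoint V * mat_adjoint C) = C" by simp
  then have CVV: "C * V * mat_adjoint V = C" using d by (simp add: mat_adjoint_mult mult_mat_assoc)
  define D where "D = mat_adjoint V * C * V"
  have D: "D \<in> carrier_mat k k" using V C by (simp add: D_def)
  have VDV: "V * D * mat_adjoint V = C"
  proof -
    have "V * D * mat_adjoint V = V * mat_adjoint V * C * V * mat_adjoint V"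
      using d by (simp add: D_def mult_mat_assoc)
    also have "\<dots> = C" by (simp add: VVC CVV)
    finally show ?thesis .
  qed
  \<comment> \<open>Since \<open>V = C X\<close>, the compression of \<open>X\<close> is a right inverse of \<open>D\<close>.\<close>
  have "D * (mat_adjoint V * X) = mat_adjoint V * (C * V * mat_adjoint V * X)"
    using d by (simp add: D_def mult_mat_assoc)
  also have "\<dots> = 1\<^sub>m k" by (simp add: CVV VV flip: VCX)
  finally have DX: "D * (mat_adjoint V * X) = 1\<^sub>m k" .
  have VX: "mat_adjoint V * X \<in> carrier_mat k k" using V X by auto
  have "invertible_mat D"
    unfolding invertible_mat_def inverts_mat_def
    using DX mat_mult_left_right_inverse[OF D VX DX] D VX by (auto intro!: exI[of _ "mat_adjoint V * X"])
  obtain W where W: "W \<in> carrier_mat n (n - k)" and U: "unitary_mat (hcat V W)"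
    using ex_orthonormal_complement[OF V VV] by metis
  have "hcat V W * four_block_mat D (0\<^sub>m k (n - k)) (0\<^sub>m (n - k) k) (0\<^sub>m (n - k) (n - k)) * mat_adjoint (hcat V W)
      = V * D * mat_adjoint V + W * 0\<^sub>m (n - k) (n - k) * mat_adjoint W"
    by (rule hcat_block_mult_adjoint_hcat[OF V W D]) simp
  also have "\<dots> = C" using W C by (simp add: VDV)
  finally show ?thesis
    using \<open>invertible_mat D\<close> D U hcat_carrier[OF V W] kn by (intro that[of D "hcat V W"]) (auto simp: rk)
qed

text \<open>With \<open>C(X) = U diag(X, 0) U\<^sup>*\<close>, products and adjoints of such matrices are computed on \<open>X\<close>
  alone.  As \<open>D\<close> and \<open>D\<^sup>*\<close> are nonsingular, each is a right multiple of the other, and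
  these two factorizations lift to \<open>C(D)\<close> and its adjoint.\<close>

lemma EP_mat_of_block_form:
  assumes D: "D \<in> carrier_mat r r" "invertible_mat D" and U: "U \<in> carrier_mat n n" "unitary_mat U"
    and rn: "r \<le> n"
  shows "EP_mat (U * four_block_mat D (0\<^sub>m r (n - r)) (0\<^sub>m (n - r) r) (0\<^sub>m (n - r) (n - r)) * mat_adjoint U)"
proof -
  let ?b = "\<lambda>X. four_block_mat X (0\<^sub>m r (n - r)) (0\<^sub>m (n - r) r) (0\<^sub>m (n - r) (n - r)) :: complex mat"
  let ?C = "\<lambda>X. U * ?b X * mat_adjoint U"
  have b: "?b X \<in> carrier_mat n n" if "X \<in> carrier_mat r r" for X
    using four_block_carrier_mat[OF that zero_carrier_mat[of "n - r" "n - r"]] rn by simp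
  have UU: "mat_adjoint U * U = 1\<^sub>m n" using U by (simp add: unitary_mat_def)
  have mult: "?C X * ?C Y = ?C (X * Y)" if X: "X \<in> carrier_mat r r" and Y: "Y \<in> carrier_mat r r" for X Y
  proof -
    note d = carrier_matD[OF b[OF X]] carrier_matD[OF b[OF Y]] carrier_matD[OF U(1)]
    have "?C X * ?C Y = U * (?b X * ((mat_adjoint U * U) * (?b Y * mat_adjoint U)))"
      using d by (simp add: mult_mat_assoc del: index_mat_four_block)
    also have "\<dots> = U * (?b X * ?b Y) * mat_adjoint U"
      using d U b[OF Y] by (simp add: UU mult_mat_assoc left_mult_one_mat[of _ n n] del: index_mat_four_block)
    also have "?b X * ?b Y = ?b (X * Y)"
      using X Y by (simp add: mult_four_block_mat[of _ r r _ "n - r" _ "n - r" _ _ r _ "n - r"])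
    finally show ?thesis .
  qed
  have C: "?C X \<in> carrier_mat n n" if "X \<in> carrier_mat r r" for X
    using mult_carrier_mat[OF mult_carrier_mat[OF U(1) b[OF that]] mat_adjoint_carrier[OF U(1)]] .
  have adj: "mat_adjoint (?C D) = ?C (mat_adjoint D)"
    using U b[OF D(1)] D
    by (simp add: mat_adjoint_mult mult_mat_assoc mat_adjoint_four_block[of _ r r _ "n - r" _ "n - r"] carrier_matD[OF b[OF D(1)]]
        carrier_matD[OF b[OF mat_adjoint_carrier[OF D(1)]]] del: index_mat_four_block)
  obtain F where F: "F \<in> carrier_mat r r" "D * F = 1\<^sub>m r" "F * D = 1\<^sub>m r"
    using D unfolding invertible_mat_def inverts_mat_def
    by (metis carrier_matD(1,2) carrier_matI index_mult_mat(2,3) index_one_mat(2,3))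
  let ?D = "mat_adjoint D" and ?F = "mat_adjoint F"
  have "?D * ?F = 1\<^sub>m r" using mat_adjoint_mult[of F D] F D by simp
  have "?C D = ?C ?D * ?C (?F * D)"
    using D F \<open>?D * ?F = 1\<^sub>m r\<close> by (subst mult) (auto simp flip: mult_mat_assoc)
  then have "range_space (?C D) \<subseteq> range_space (?C ?D)"
    using range_space_mult_subset[OF C[of ?D] C[of "?F * D"]] D F by simp
  moreover have "?C ?D = ?C D * ?C (F * ?D)"
    using D F by (subst mult) (auto simp flip: mult_mat_assoc)
  then have "range_space (?C ?D) \<subseteq> range_space (?C D)"
    using range_space_mult_subset[OF C[of D] C[of "F * ?D"]] D F by simp
  ultimately show ?thesis using C[OF D(1)] unfolding EP_mat_def adj by simp
qed

text \<open>\<open>P\<close> fixes every vector in the range of \<open>C\<close>, which is also the range of \<open>C\<^sup>*\<close>; the adjoint of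
  \<open>P C\<^sup>* = C\<^sup>*\<close> is the claim.\<close>

lemma EP_mat_absorb_right:
  assumes C: "C \<in> carrier_mat n n" and EP: "EP_mat C" and P: "P \<in> carrier_mat n n"
    and herm: "mat_adjoint P = P" and PC: "P * C = C"
  shows "C * P = C"
proof -
  obtain Z where Z: "Z \<in> carrier_mat n n" "mat_adjoint C = C * Z"
    using EP C range_space_subset_iff[of "mat_adjoint C" n n C n] by (auto simp: EP_mat_def)
  have "P * mat_adjoint C = P * C * Z" using P C Z by (simp add: mult_mat_assoc)
  also have "\<dots> = mat_adjoint C" by (simp add: PC Z)
  finally have "mat_adjoint (P * mat_adjoint C) = C" by simp
  then show ?thesis using P C by (simp add: mat_adjoint_mult herm)
qed

section \<open>The equivalence\<close>

text \<open>The chain of ranges is \<open>R(A T\<^sup>*) = R(A) = R(T A\<^sup>* T) = R(T A\<^sup>*)\<close>, and \<open>T A\<^sup>*\<close> is the adjoint of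
  \<open>A T\<^sup>*\<close>.  The last equality needs \<open>A\<^sup>* = A\<^sup>* T T\<^sup>*\<close>, the adjoint of \<open>T T\<^sup>* A = A\<close>; this holds because
  \<open>A\<close> has its range inside that of \<open>T\<close>.\<close>

lemma T_EP_imp_EP_factor:
  assumes A: "A \<in> carrier_mat n n" and T: "T \<in> carrier_mat n n" and iso: "partial_isometry T"
    and TEP: "T_EP_mat T A"
  shows "EP_mat (A * mat_adjoint T)" "A = A * mat_adjoint T * T"
    "T * mat_adjoint T * (A * mat_adjoint T) = A * mat_adjoint T"
proof -
  note d = carrier_matD[OF A] carrier_matD[OF T]
  let ?A = "mat_adjoint A" and ?T = "mat_adjoint T"
  have TTT: "T * ?T * T = T" using iso by (simp add: partial_isometry_def)
  have ran: "range_space A = range_space (T * ?A * T)" and ATT: "A = A * ?T * T"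
    using TEP by (auto simp: T_EP_mat_def)
  show "A = A * ?T * T" by (rule ATT)
  obtain Z where Z: "Z \<in> carrier_mat n n" "A = T * ?A * T * Z"
    using ran A T range_space_subset_iff[of A n n "T * ?A * T" n] by auto
  have "T * ?T * A = T * ?T * T * (?A * T * Z)"
    using d Z by (subst Z) (simp add: mult_mat_assoc)
  also have "\<dots> = A" using d Z by (subst (2) Z) (simp add: TTT mult_mat_assoc)
  finally have PA: "T * ?T * A = A" .
  then show "T * ?T * (A * ?T) = A * ?T" using d by (simp flip: mult_mat_assoc)
  have rC: "range_space (A * ?T) = range_space A"
  proof
    show "range_space (A * ?T) \<subseteq> range_space A" by (rule range_space_mult_subset[OF A mat_adjoint_carrier[OF T]])
    show "range_space A \<subseteq> range_space (A * ?T)"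
      using range_space_mult_subset[of "A * ?T" n n T n] A T ATT by simp
  qed
  have APP: "?A = ?A * T * ?T"
    using arg_cong[OF PA, of mat_adjoint] d by (simp add: mat_adjoint_mult mult_mat_assoc)
  have "range_space (T * ?A) = range_space (T * ?A * T)"
  proof
    show "range_space (T * ?A * T) \<subseteq> range_space (T * ?A)"
      by (rule range_space_mult_subset[of _ n n _ n]) (use A T in auto)
    have "T * ?A = T * ?A * T * ?T" using d by (subst APP) (simp add: mult_mat_assoc)
    then show "range_space (T * ?A) \<subseteq> range_space (T * ?A * T)"
      using range_space_mult_subset[of "T * ?A * T" n n ?T n] A T by simp
  qed
  then show "EP_mat (A * ?T)"
    using d rC ran by (simp add: EP_mat_def mat_adjoint_mult)
qed

text \<open>For \<open>A = C T\<close>, the matrix \<open>T A\<^sup>* T = T T\<^sup>* C\<^sup>* T\<close> collapses to \<open>C\<^sup>* T\<close>, and multiplication by \<open>T\<close>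
  on the right changes neither the range of \<open>C\<close> nor that of \<open>C\<^sup>*\<close>, because a further factor \<open>T\<^sup>*\<close>
  restores them.\<close>

lemma EP_factor_imp_T_EP:
  assumes T: "T \<in> carrier_mat n n" and C: "C \<in> carrier_mat n n" and EP: "EP_mat C"
    and PC: "T * mat_adjoint T * C = C"
  shows "T_EP_mat T (C * T)" "C * T * mat_adjoint T = C" "range_space (C * T) = range_space C"
proof -
  note d = carrier_matD[OF C] carrier_matD[OF T]
  let ?C = "mat_adjoint C" and ?T = "mat_adjoint T"
  have "C * (T * ?T) = C"
    by (rule EP_mat_absorb_right[OF C EP _ _ PC]) (use T in \<open>auto simp: mat_adjoint_mult\<close>)
  then show CP: "C * T * ?T = C" using d by (simp add: mult_mat_assoc)
  show rCT: "range_space (C * T) = range_space C"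
  proof
    show "range_space (C * T) \<subseteq> range_space C" by (rule range_space_mult_subset[OF C T])
    show "range_space C \<subseteq> range_space (C * T)"
      using range_space_mult_subset[of "C * T" n n ?T n] C T CP by simp
  qed
  have PCs: "T * ?T * ?C = ?C"
    using arg_cong[OF CP, of mat_adjoint] d by (simp add: mat_adjoint_mult mult_mat_assoc)
  have CPs: "?C * T * ?T = ?C"
    using arg_cong[OF PC, of mat_adjoint] d by (simp add: mat_adjoint_mult mult_mat_assoc)
  have "T * mat_adjoint (C * T) * T = ?C * T"
    using d by (simp add: mat_adjoint_mult PCs flip: mult_mat_assoc)
  moreover have "range_space (?C * T) = range_space ?C"
  proof
    show "range_space (?C * T) \<subseteq> range_space ?C" by (rule range_space_mult_subset[OF _ T]) (use C in auto)
    show "range_space ?C \<subseteq> range_space (?C * T)"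
      using range_space_mult_subset[of "?C * T" n n ?T n] C T CPs by simp
  qed
  ultimately show "T_EP_mat T (C * T)"
    using EP rCT by (simp add: T_EP_mat_def EP_mat_def CP)
qed

text \<open>Conjugation by \<open>U\<close> turns \<open>T T\<^sup>* C = C\<close> into \<open>S S\<^sup>* E = E\<close> for the block matrices \<open>S\<close> of \<open>T\<close> and
  \<open>E = diag(D, 0)\<close>.  Only the first block column of \<open>S S\<^sup>*\<close> survives the multiplication by \<open>E\<close>, and
  the factor \<open>D\<close> cancels.\<close>

lemma block_rows_orthonormal_iff:
  assumes D: "D \<in> carrier_mat r r" "invertible_mat D" and U: "U \<in> carrier_mat n n" "unitary_mat U"
    and T1: "T1 \<in> carrier_mat r r" and T2: "T2 \<in> carrier_mat r (n - r)"
    and T3: "T3 \<in> carrier_mat (n - r) r" and T4: "T4 \<in> carrier_mat (n - r) (n - r)"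
    and rn: "r \<le> n"
    and T: "T = U * four_block_mat T1 T2 T3 T4 * mat_adjoint U"
    and C: "C = U * four_block_mat D (0\<^sub>m r (n - r)) (0\<^sub>m (n - r) r) (0\<^sub>m (n - r) (n - r)) * mat_adjoint U"
  shows "T * mat_adjoint T * C = C \<longleftrightarrow>
    T1 * mat_adjoint T1 + T2 * mat_adjoint T2 = 1\<^sub>m r \<and>
    T3 * mat_adjoint T1 + T4 * mat_adjoint T2 = 0\<^sub>m (n - r) r"
proof -
  define S where "S = four_block_mat T1 T2 T3 T4"
  define E where "E = four_block_mat D (0\<^sub>m r (n - r)) (0\<^sub>m (n - r) r) (0\<^sub>m (n - r) (n - r))"
  let ?X = "T1 * mat_adjoint T1 + T2 * mat_adjoint T2"
  let ?Y = "T3 * mat_adjoint T1 + T4 * mat_adjoint T2"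
  have S: "S \<in> carrier_mat n n" using four_block_carrier_mat[OF T1 T4] rn by (simp add: S_def)
  have E: "E \<in> carrier_mat n n"
    using four_block_carrier_mat[OF D(1) zero_carrier_mat[of "n - r" "n - r"]] rn by (simp add: E_def)
  have UU: "mat_adjoint U * U = 1\<^sub>m n" using U by (simp add: unitary_mat_def)
  have UUl: "mat_adjoint U * (U * M) = M" if "dim_row M = n" for M
    using that U by (simp add: UU flip: mult_mat_assoc)
  note d = carrier_matD[OF S] carrier_matD[OF E] carrier_matD[OF U(1)]
  have TTC: "T * mat_adjoint T * C = U * (S * mat_adjoint S * E) * mat_adjoint U"
    using d unfolding T C S_def[symmetric] E_def[symmetric]
    by (simp add: mat_adjoint_mult mult_mat_assoc UUl)
  have "T * mat_adjoint T * C = C \<longleftrightarrow> S * mat_adjoint S * E = E"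
  proof
    assume "T * mat_adjoint T * C = C"
    then have eq: "U * (S * mat_adjoint S * E) * mat_adjoint U = U * E * mat_adjoint U"
      by (simp only: TTC) (simp add: C E_def)
    have cancel: "mat_adjoint U * (U * M * mat_adjoint U) * U = M" if M: "M \<in> carrier_mat n n" for M
      using d carrier_matD[OF M] right_mult_one_mat[OF M] by (simp add: mult_mat_assoc UUl UU)
    show "S * mat_adjoint S * E = E"
      using arg_cong[OF eq, of "\<lambda>M. mat_adjoint U * M * U"] S E by (simp add: cancel)
  next
    assume "S * mat_adjoint S * E = E"
    then show "T * mat_adjoint T * C = C" by (simp only: TTC) (simp add: C E_def)
  qed
  also have "S * mat_adjoint S * E =
      four_block_mat (?X * D) (0\<^sub>m r (n - r)) (?Y * D) (0\<^sub>m (n - r) (n - r))"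
    unfolding S_def E_def mat_adjoint_four_block[OF T1 T2 T3 T4]
    using T1 T2 T3 T4 D
    by (simp add: mult_four_block_mat[of _ r r _ "n - r" _ "n - r" _ _ r _ "n - r"])
  also have "\<dots> = E \<longleftrightarrow> ?X * D = D \<and> ?Y * D = 0\<^sub>m (n - r) r"
  proof
    assume eq: "four_block_mat (?X * D) (0\<^sub>m r (n - r)) (?Y * D) (0\<^sub>m (n - r) (n - r)) = E"
    have e: "four_block_mat (?X * D) (0\<^sub>m r (n - r)) (?Y * D) (0\<^sub>m (n - r) (n - r)) $$ (i, j) = E $$ (i, j)"
      for i j by (simp only: eq)
    show "?X * D = D \<and> ?Y * D = 0\<^sub>m (n - r) r"
    proof
      show "?X * D = D"
      proof (rule eq_matI)
        fix i j assume "i < dim_row D" "j < dim_col D"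
        then show "(?X * D) $$ (i, j) = D $$ (i, j)"
          using e[of i j] D T1 T2 T3 T4 by (simp add: E_def)
      qed (use T1 T2 D in auto)
      show "?Y * D = 0\<^sub>m (n - r) r"
      proof (rule eq_matI)
        fix i j assume "i < dim_row (0\<^sub>m (n - r) r :: complex mat)" "j < dim_col (0\<^sub>m (n - r) r :: complex mat)"
        then show "(?Y * D) $$ (i, j) = 0\<^sub>m (n - r) r $$ (i, j)"
          using e[of "r + i" j] D T1 T2 T3 T4 by (simp add: E_def)
      qed (use T3 T4 D in auto)
    qed
  qed (simp add: E_def)
  also have "\<dots> \<longleftrightarrow> ?X = 1\<^sub>m r \<and> ?Y = 0\<^sub>m (n - r) r"
  proof -
    obtain F where F: "F \<in> carrier_mat r r" "D * F = 1\<^sub>m r"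
      using D unfolding invertible_mat_def inverts_mat_def
      by (metis carrier_matD(1,2) carrier_matI index_mult_mat(2,3) index_one_mat(2,3))
    have MDF: "M * D * F = M" if M: "M \<in> carrier_mat m r" for M m
      using right_mult_one_mat[OF M] carrier_matD[OF M] D F by (simp add: mult_mat_assoc)
    have X: "?X \<in> carrier_mat r r" and Y: "?Y \<in> carrier_mat (n - r) r" using T1 T2 T3 T4 by auto
    show ?thesis
    proof
      assume h: "?X * D = D \<and> ?Y * D = 0\<^sub>m (n - r) r"
      show "?X = 1\<^sub>m r \<and> ?Y = 0\<^sub>m (n - r) r"
        using MDF[OF X] MDF[OF Y] h F by simp
    qed (use D in simp)
  qed
  finally show ?thesis .
qed

theorem theorem3p14:
  fixes A T :: "complex mat" and n r :: nat
  assumes A: "A \<in> carrier_mat n n"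
    and T: "T \<in> carrier_mat n n"
    and T_iso: "partial_isometry T"
    and r: "r = vec_space.rank n A"
  defines "cond_i \<equiv> T_EP_mat T A"
    and "cond_ii \<equiv>
      (\<exists>D U T1 T2 T3 T4.
         D \<in> carrier_mat r r \<and> invertible_mat D \<and>
         U \<in> carrier_mat n n \<and> unitary_mat U \<and>
         A = U * four_block_mat D (0\<^sub>m r (n - r)) (0\<^sub>m (n - r) r) (0\<^sub>m (n - r) (n - r))
               * mat_adjoint U * T \<and>
         T1 \<in> carrier_mat r r \<and> T2 \<in> carrier_mat r (n - r) \<and>
         T3 \<in> carrier_mat (n - r) r \<and> T4 \<in> carrier_mat (n - r) (n - r) \<and>
         T = U * four_block_mat T1 T2 T3 T4 * mat_adjoint U \<and>
         T1 * mat_adjoint T1 + T2 * mat_adjoint T2 = 1\<^sub>m r \<and>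
         T3 * mat_adjoint T1 + T4 * mat_adjoint T2 = 0\<^sub>m (n - r) r)"
    and "is_C \<equiv> (\<lambda>C. C \<in> carrier_mat n n \<and> EP_mat C \<and> A = C * T \<and> T * mat_adjoint T * C = C)"
  shows "(cond_i \<longleftrightarrow> cond_ii) \<and> (cond_ii \<longleftrightarrow> (\<exists>C. is_C C)) \<and>
         (\<forall>C. is_C C \<longrightarrow> C * T * mat_adjoint T = C)"
proof -
  have rn: "r \<le> n" using vec_space.rank_le_nc[OF A] by (simp add: r)
  have "\<exists>C. is_C C" if "cond_i"
    using T_EP_imp_EP_factor[OF A T T_iso] that A T
    by (intro exI[of _ "A * mat_adjoint T"]) (auto simp: cond_i_def is_C_def)
  moreover have C_imp: "cond_i \<and> C * T * mat_adjoint T = C \<and> range_space A = range_space C" if "is_C C" for C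
    using EP_factor_imp_T_EP[OF T, of C] that by (auto simp: cond_i_def is_C_def)
  moreover have cond_ii if C: "is_C C" for C
  proof -
    have C': "C \<in> carrier_mat n n" "EP_mat C" "A = C * T" "T * mat_adjoint T * C = C"
      using C by (auto simp: is_C_def)
    have "r = vec_space.rank n C"
      using rank_cong_range_space[OF A C'(1)] C_imp[OF C] by (simp add: r)
    then obtain D U where D: "D \<in> carrier_mat r r" "invertible_mat D" and U: "U \<in> carrier_mat n n" "unitary_mat U"
      and CD: "C = U * four_block_mat D (0\<^sub>m r (n - r)) (0\<^sub>m (n - r) r) (0\<^sub>m (n - r) (n - r)) * mat_adjoint U"
      using EP_mat_block_form[OF C'(1,2)] by metis
    define S where "S = mat_adjoint U * T * U"
    obtain T1 T2 T3 T4 where split: "split_block S r r = (T1, T2, T3, T4)" by (metis prod_cases4)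
    have S: "dim_row S = r + (n - r)" "dim_col S = r + (n - r)" using U T rn by (auto simp: S_def)
    note blocks = split_block[OF split S]
    have UU: "U * mat_adjoint U = 1\<^sub>m n" using U by (simp add: unitary_mat_def)
    have "U * S * mat_adjoint U = (U * mat_adjoint U) * (T * (U * mat_adjoint U))"
      using U T by (simp add: S_def mult_mat_assoc)
    also have "\<dots> = T" using T by (simp add: UU)
    finally have "T = U * four_block_mat T1 T2 T3 T4 * mat_adjoint U" using blocks(5) by simp
    with block_rows_orthonormal_iff[OF D U blocks(1-4) rn this CD] show ?thesis
      unfolding cond_ii_def using D U blocks(1-4) C'(3,4) CD by metis
  qed
  moreover have "\<exists>C. is_C C" if c2: cond_ii
  proof -
    obtain D U T1 T2 T3 T4 where
      D: "D \<in> carrier_mat r r" "invertible_mat D" and U: "U \<in> carrier_mat n n" "unitary_mat U"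
      and AU: "A = U * four_block_mat D (0\<^sub>m r (n - r)) (0\<^sub>m (n - r) r) (0\<^sub>m (n - r) (n - r)) * mat_adjoint U * T"
      and blocks: "T1 \<in> carrier_mat r r" "T2 \<in> carrier_mat r (n - r)"
        "T3 \<in> carrier_mat (n - r) r" "T4 \<in> carrier_mat (n - r) (n - r)"
      and TU: "T = U * four_block_mat T1 T2 T3 T4 * mat_adjoint U"
      and rows: "T1 * mat_adjoint T1 + T2 * mat_adjoint T2 = 1\<^sub>m r"
        "T3 * mat_adjoint T1 + T4 * mat_adjoint T2 = 0\<^sub>m (n - r) r"
      using c2 unfolding cond_ii_def by blast
    let ?C = "U * four_block_mat D (0\<^sub>m r (n - r)) (0\<^sub>m (n - r) r) (0\<^sub>m (n - r) (n - r)) * mat_adjoint U"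
    have "?C \<in> carrier_mat n n" using U by (auto intro!: carrier_matI)
    moreover have "T * mat_adjoint T * ?C = ?C"
      using block_rows_orthonormal_iff[OF D U blocks rn TU refl] rows by simp
    ultimately have "is_C ?C" using EP_mat_of_block_form[OF D U rn] AU by (simp add: is_C_def)
    then show ?thesis ..
  qed
  ultimately show ?thesis by blast
qed

end
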